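(* Let $N>0$ be a real number and let $r$ be an odd positive integer. Let $a_r, a_{r-1},\ldots,a_1$ be positive integers chosen successively as follows: $a_r>N+1$, and put $s_r=1-\frac{N+1}{a_r}$; then for $i=r-1,r-2,\ldots,1$: if $i$ is even, choose $a_i>\frac{N}{s_{i+1}}$ and put $s_i=g\!\left(s_{i+1},-\frac{N}{a_i}\right)$; if $i$ is odd, choose $a_i>\frac{N+1}{1-\frac{1}{s_{i+1}}}$ and put $s_i=f\!\left(s_{i+1},1-\frac{N+1}{a_i}\right)$. Then the threshold graph $T_G(a_1,a_2,\ldots,a_r)$ is $(0,N]$-eigenvalue free.
   Context: All graphs are finite, simple and undirected; eigenvalues are those of the adjacency matrix. A graph is $I$-eigenvalue free, for an interval $I\subseteq\mathbb{R}$, if it has no eigenvalue in $I$. For an integer $r\ge 1$ and positive integers $a_1,\ldots,a_r$ with $a_r\ge 2$, the threshold graph $T_G(a_1,\ldots,a_r)$ is defined as follows: start with $G_r=K_{a_r}$ (complete graph) if $r$ is odd and $G_r=\overline{K_{a_r}}$ ($a_r$ isolated vertices) if $r$ is even; for $i=r-1,\ldots,1$, let $G_i$ be obtained from $G_{i+1}$ by adding $a_i$ new vertices which are adjacent to each other and to all vertices of $G_{i+1}$ if $i$ is odd, and by adding $a_i$ new isolated vertices if $i$ is even; then $T_G(a_1,\ldots,a_r)=G_1$. (Equivalently, in the cotree, the interior node at depth $i$ is a join node if $i$ is odd and a union node if $i$ is even, and has $a_i$ leaves.) The functions $f,g$ are $f(X,Y)=\frac{XY-1}{X+Y-2}$ and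 $g(X,Y)=\frac{XY}{X+Y}$. *)

theory Defs
  imports "Graph_Theory.Pair_Digraph" "Jordan_Normal_Form.Char_Poly"
begin

text \<open>
  A finite simple undirected graph is a \<^const>\<open>pair_graph\<close>: the undirected edge
  \<open>uv\<close> is represented by the two arcs \<open>(u, v)\<close> and \<open>(v, u)\<close>.
\<close>

definition complete_graph_on :: "'a set \<Rightarrow> 'a pair_pre_digraph" where
  "complete_graph_on W = \<lparr>pverts = W, parcs = {(u, v). u \<in> W \<and> v \<in> W \<and> u \<noteq> v}\<rparr>"

definition edgeless_graph_on :: "'a set \<Rightarrow> 'a pair_pre_digraph" where
  "edgeless_graph_on W = \<lparr>pverts = W, parcs = {}\<rparr>"

text \<open>In the next two definitions \<open>W\<close> is meant to be disjoint from the vertices of \<open>G\<close>.\<close>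

definition add_dominating :: "'a set \<Rightarrow> 'a pair_pre_digraph \<Rightarrow> 'a pair_pre_digraph" where
  "add_dominating W G =
     \<lparr>pverts = W \<union> pverts G,
      parcs = parcs G \<union> {(u, v). u \<in> W \<and> v \<in> W \<and> u \<noteq> v} \<union> W \<times> pverts G \<union> pverts G \<times> W\<rparr>"

definition add_isolated :: "'a set \<Rightarrow> 'a pair_pre_digraph \<Rightarrow> 'a pair_pre_digraph" where
  "add_isolated W G = \<lparr>pverts = W \<union> pverts G, parcs = parcs G\<rparr>"

text \<open>
  The \<open>m\<close> vertices introduced at depth \<open>i\<close>. Tagging them with \<open>i\<close> makes the vertex sets
  of different depths disjoint.
\<close>

definition level_verts :: "nat \<Rightarrow> nat \<Rightarrow> (nat \<times> nat) set" where
  "level_verts i m = {i} \<times> {..<m}"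

text \<open>
  \<open>threshold_from i [a\<^sub>i, \<dots>, a\<^sub>r]\<close> is the graph \<open>G\<^sub>i\<close>, so that
  \<open>T\<^sub>G(a\<^sub>1, \<dots>, a\<^sub>r) = G\<^sub>1\<close>. The empty list is a junk case.
\<close>

fun threshold_from :: "nat \<Rightarrow> nat list \<Rightarrow> (nat \<times> nat) pair_pre_digraph" where
  "threshold_from i [] = edgeless_graph_on {}"
| "threshold_from i [m] =
     (if odd i then complete_graph_on (level_verts i m) else edgeless_graph_on (level_verts i m))"
| "threshold_from i (m # n # ns) =
     (if odd i then add_dominating (level_verts i m) (threshold_from (Suc i) (n # ns))
      else add_isolated (level_verts i m) (threshold_from (Suc i) (n # ns)))"

definition threshold_graph :: "nat list \<Rightarrow> (nat \<times> nat) pair_pre_digraph" where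
  "threshold_graph as = threshold_from 1 as"

definition adjacency_matrix :: "'a list \<Rightarrow> 'a pair_pre_digraph \<Rightarrow> real mat" where
  "adjacency_matrix vs G =
     mat (length vs) (length vs) (\<lambda>(i, j). if (vs ! i, vs ! j) \<in> parcs G then 1 else 0)"

text \<open>
  The list \<open>vs\<close> enumerates the vertices; different enumerations give similar adjacency
  matrices. These are real symmetric, so all their eigenvalues are real.
\<close>

definition graph_eigenvalue :: "'a pair_pre_digraph \<Rightarrow> real \<Rightarrow> bool" where
  "graph_eigenvalue G k \<longleftrightarrow>
     (\<exists>vs. distinct vs \<and> set vs = pverts G \<and> eigenvalue (adjacency_matrix vs G) k)"

definition eigenvalue_free :: "real set \<Rightarrow> 'a pair_pre_digraph \<Rightarrow> bool" where
  "eigenvalue_free I G \<longleftrightarrow> (\<forall>k\<in>I. \<not> graph_eigenvalue G k)"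

definition f_fun :: "real \<Rightarrow> real \<Rightarrow> real" where
  "f_fun X Y = (X * Y - 1) / (X + Y - 2)"

definition g_fun :: "real \<Rightarrow> real \<Rightarrow> real" where
  "g_fun X Y = X * Y / (X + Y)"

lemma threshold_from_levels: "p \<in> pverts (threshold_from i as) \<Longrightarrow> i \<le> fst p"
  by (induction i as arbitrary: p rule: threshold_from.induct)
     (force simp: complete_graph_on_def edgeless_graph_on_def add_dominating_def add_isolated_def
        level_verts_def split: if_splits dest: Suc_leD)+

lemma level_verts_disjoint: "level_verts i m \<inter> pverts (threshold_from (Suc i) as) = {}"
  using threshold_from_levels[of _ "Suc i" as] by (force simp: level_verts_def)

lemma pair_graphI:
  assumes "finite (pverts G)" "parcs G \<subseteq> pverts G \<times> pverts G" "sym (parcs G)"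
    and "\<And>u. (u, u) \<notin> parcs G"
  shows "pair_graph G"
proof
  show "finite (parcs G)"
    using assms(1,2) finite_subset by blast
  show "symmetric (with_proj G)"
    using assms(3) by (simp add: symmetric_def arcs_ends_conv)
qed (use assms in \<open>auto\<close>)

lemma pair_graph_threshold_from: "pair_graph (threshold_from i as)"
proof -
  have fin: "finite (level_verts i m)" for i m
    by (simp add: level_verts_def)
  have "finite (pverts G) \<and> parcs G \<subseteq> pverts G \<times> pverts G \<and> sym (parcs G) \<and> (\<forall>u. (u, u) \<notin> parcs G)"
    if "G = threshold_from i as" for G
    using that
  proof (induction i as arbitrary: G rule: threshold_from.induct)
    case (3 i m n ns)
    define H where "H = threshold_from (Suc i) (n # ns)"
    have H: "finite (pverts H)" "parcs H \<subseteq> pverts H \<times> pverts H" "sym (parcs H)"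
        "\<And>u. (u, u) \<notin> parcs H"
      using "3.IH" unfolding H_def by (cases "odd i"; blast)+
    have disj: "level_verts i m \<inter> pverts H = {}"
      unfolding H_def by (rule level_verts_disjoint)
    have G: "G = (if odd i then add_dominating (level_verts i m) H else add_isolated (level_verts i m) H)"
      using "3.prems" by (simp add: H_def)
    show ?case
      using H disj fin unfolding G
      by (auto simp: add_dominating_def add_isolated_def sym_def)
  qed (auto simp: complete_graph_on_def edgeless_graph_on_def fin sym_def)
  then show ?thesis
    by (intro pair_graphI) auto
qed

lemma pair_graph_threshold_graph: "pair_graph (threshold_graph as)"
  unfolding threshold_graph_def by (rule pair_graph_threshold_from)

end

theory Submission
  imports Defs
begin

text \<open>
  Let \<open>A\<close> be the adjacency matrix of \<open>G\<close>. Call \<open>\<sigma>\<close> the pivot of \<open>G\<close> at \<open>k\<close> if \<open>(k I - A) h = d 1\<close>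
  forces \<open>d = - \<sigma> 1\<^sup>T h\<close> and, when \<open>1\<^sup>T h = 0\<close>, also \<open>h = 0\<close>. If the pivot is not zero, then \<open>d = 0\<close>
  forces \<open>h = 0\<close>, so that \<open>k\<close> is not an eigenvalue. The pivots \<open>X\<close> and \<open>Y\<close> of two graphs determine
  those of their disjoint union and of their join, namely \<open>g X Y\<close> and \<open>f X Y\<close>. A level of \<open>m\<close>
  isolated vertices has pivot \<open>- k / m\<close> and a complete one \<open>1 - (k + 1) / m\<close>, so \<open>s\<^sub>i\<close> is the
  pivot of \<open>G\<^sub>i\<close> at \<open>N\<close>. On the relevant ranges \<open>f\<close> and \<open>g\<close> are monotone, and therefore for
  \<open>0 < k \<le> N\<close> the pivot of \<open>G\<^sub>i\<close> at \<open>k\<close> exists and lies in \<open>[s\<^sub>i, 1)\<close> with \<open>s\<^sub>i > 0\<close> for odd \<open>i\<close>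
  and in \<open>[s\<^sub>i, 0)\<close> for even \<open>i\<close>.
\<close>


section \<open>Eigenvalues and pivots\<close>

definition shifted_eigenvector ::
    "'a pair_pre_digraph \<Rightarrow> real \<Rightarrow> real \<Rightarrow> ('a \<Rightarrow> real) \<Rightarrow> bool" where
  "shifted_eigenvector G k d h \<longleftrightarrow> (\<forall>u\<in>pverts G. k * h u = d + sum h (parcs G `` {u}))"

text \<open>
  If \<open>\<sigma> \<noteq> 0\<close>, this says that \<open>A - k I\<close> is invertible and \<open>1\<^sup>T (A - k I)\<^sup>-\<^sup>1 1 = 1 / \<sigma>\<close>. Asking for
  \<open>h = 0\<close> only when \<open>1\<^sup>T h = 0\<close> also admits \<open>\<sigma> = 0\<close>, which a complete level attains if it has
  \<open>k + 1\<close> vertices.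
\<close>

definition has_pivot :: "'a pair_pre_digraph \<Rightarrow> real \<Rightarrow> real \<Rightarrow> bool" where
  "has_pivot G k \<sigma> \<longleftrightarrow>
     (\<forall>d h. shifted_eigenvector G k d h \<longrightarrow>
        d = - \<sigma> * sum h (pverts G) \<and> (sum h (pverts G) = 0 \<longrightarrow> (\<forall>u\<in>pverts G. h u = 0)))"

lemma has_pivotI:
  assumes "\<And>d h. shifted_eigenvector G k d h \<Longrightarrow> d = - \<sigma> * sum h (pverts G)"
    and "\<And>d h u. shifted_eigenvector G k d h \<Longrightarrow> sum h (pverts G) = 0 \<Longrightarrow> u \<in> pverts G \<Longrightarrow> h u = 0"
  shows "has_pivot G k \<sigma>"
  using assms unfolding has_pivot_def by blast

lemma has_pivot_sum:
  assumes "has_pivot G k \<sigma>" "shifted_eigenvector G k d h"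
  shows "d = - \<sigma> * sum h (pverts G)"
  using assms unfolding has_pivot_def by blast

lemma has_pivot_eq_0:
  assumes "has_pivot G k \<sigma>" "shifted_eigenvector G k d h" "sum h (pverts G) = 0" "u \<in> pverts G"
  shows "h u = 0"
  using assms unfolding has_pivot_def by blast

lemma adjacency_matrix_mult_vec:
  assumes "pair_wf_digraph G" "distinct vs" "set vs = pverts G" "i < length vs"
  shows "(adjacency_matrix vs G *\<^sub>v vec (length vs) (\<lambda>j. h (vs ! j))) $ i
    = sum h (parcs G `` {vs ! i})"
proof -
  interpret pair_wf_digraph G by fact
  have "(adjacency_matrix vs G *\<^sub>v vec (length vs) (\<lambda>j. h (vs ! j))) $ i
      = (\<Sum>j<length vs. if (vs ! i, vs ! j) \<in> parcs G then h (vs ! j) else 0)"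
    using assms(4)
    by (auto simp: adjacency_matrix_def scalar_prod_def lessThan_atLeast0 intro!: sum.cong)
  also have "\<dots> = (\<Sum>w\<in>pverts G. if (vs ! i, w) \<in> parcs G then h w else 0)"
    using bij_betw_nth[OF assms(2) refl assms(3)[symmetric]] by (rule sum.reindex_bij_betw)
  also have "\<dots> = sum h {w \<in> pverts G. (vs ! i, w) \<in> parcs G}"
    using assms(3) by (intro sum.inter_filter[symmetric]) (metis List.finite_set)
  also have "{w \<in> pverts G. (vs ! i, w) \<in> parcs G} = parcs G `` {vs ! i}"
    using in_arcsD2 by auto
  finally show ?thesis .
qed

lemma graph_eigenvalue_imp_shifted_eigenvector:
  assumes "pair_wf_digraph G" "graph_eigenvalue G k"
  obtains h u where "shifted_eigenvector G k 0 h" "u \<in> pverts G" "h u \<noteq> 0"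
proof -
  obtain vs where vs: "distinct vs" "set vs = pverts G"
    and eigenvalue: "eigenvalue (adjacency_matrix vs G) k"
    using assms(2) unfolding graph_eigenvalue_def by blast
  let ?n = "length vs"
  obtain v where v: "v \<in> carrier_vec ?n" "v \<noteq> 0\<^sub>v ?n"
    and eigenvector: "adjacency_matrix vs G *\<^sub>v v = k \<cdot>\<^sub>v v"
    using eigenvalue unfolding eigenvalue_def eigenvector_def by (auto simp: adjacency_matrix_def)
  define h where "h u = v $ inv_into {..<?n} ((!) vs) u" for u
  have h_nth: "h (vs ! i) = v $ i" if "i < ?n" for i
    using that inj_on_nth[OF vs(1), of "{..<?n}"] by (simp add: h_def)
  then have v_eq: "v = vec ?n (\<lambda>j. h (vs ! j))"
    using v(1) by auto
  have "shifted_eigenvector G k 0 h"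
    unfolding shifted_eigenvector_def
  proof
    fix u assume "u \<in> pverts G"
    then obtain i where i: "i < ?n" "u = vs ! i"
      using vs(2) by (metis in_set_conv_nth)
    have "k * h u = (adjacency_matrix vs G *\<^sub>v v) $ i"
      using i v(1) h_nth eigenvector by simp
    also have "\<dots> = sum h (parcs G `` {u})"
      unfolding i(2) by (subst v_eq) (rule adjacency_matrix_mult_vec[OF assms(1) vs i(1)])
    finally show "k * h u = 0 + sum h (parcs G `` {u})"
      by simp
  qed
  moreover obtain i where "i < ?n" "v $ i \<noteq> 0"
    using v by (metis carrier_vecD eq_vecI index_zero_vec(1,2))
  then have "vs ! i \<in> pverts G" "h (vs ! i) \<noteq> 0"
    using h_nth vs(2) by (auto simp flip: vs(2))
  ultimately show ?thesis
    using that by blast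
qed

lemma has_pivot_imp_not_graph_eigenvalue:
  assumes "pair_wf_digraph G" "has_pivot G k \<sigma>" "\<sigma> \<noteq> 0"
  shows "\<not> graph_eigenvalue G k"
proof
  assume "graph_eigenvalue G k"
  then obtain h u where h: "shifted_eigenvector G k 0 h" and u: "u \<in> pverts G" "h u \<noteq> 0"
    using assms(1) graph_eigenvalue_imp_shifted_eigenvector by blast
  have "sum h (pverts G) = 0"
    using has_pivot_sum[OF assms(2) h] assms(3) by simp
  then show False
    using has_pivot_eq_0[OF assms(2) h] u by blast
qed


section \<open>Pivots of unions and joins\<close>

definition graph_union ::
    "'a pair_pre_digraph \<Rightarrow> 'a pair_pre_digraph \<Rightarrow> 'a pair_pre_digraph" where
  "graph_union G H = \<lparr>pverts = pverts G \<union> pverts H, parcs = parcs G \<union> parcs H\<rparr>"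

definition graph_join ::
    "'a pair_pre_digraph \<Rightarrow> 'a pair_pre_digraph \<Rightarrow> 'a pair_pre_digraph" where
  "graph_join G H =
     \<lparr>pverts = pverts G \<union> pverts H,
      parcs = parcs G \<union> parcs H \<union> pverts G \<times> pverts H \<union> pverts H \<times> pverts G\<rparr>"

lemma graph_union_commute: "graph_union G H = graph_union H G"
  by (auto simp: graph_union_def)

lemma graph_join_commute: "graph_join G H = graph_join H G"
  by (auto simp: graph_join_def)

lemma shifted_eigenvector_graph_union_left:
  assumes "pair_wf_digraph H" "pverts G \<inter> pverts H = {}"
    and "shifted_eigenvector (graph_union G H) k d h"
  shows "shifted_eigenvector G k d h"
proof -
  have "parcs (graph_union G H) `` {u} = parcs G `` {u}" if "u \<in> pverts G" for u
    using that assms(2) pair_wf_digraph.in_arcsD1[OF assms(1)] by (auto simp: graph_union_def)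
  then show ?thesis
    using assms(3) by (simp add: shifted_eigenvector_def graph_union_def)
qed

lemma shifted_eigenvector_graph_join_left:
  assumes "pair_fin_digraph G" "pair_fin_digraph H" "pverts G \<inter> pverts H = {}"
    and "shifted_eigenvector (graph_join G H) k d h"
  shows "shifted_eigenvector G k (d + sum h (pverts H)) h"
  unfolding shifted_eigenvector_def
proof
  interpret G: pair_fin_digraph G by fact
  interpret H: pair_fin_digraph H by fact
  fix u assume u: "u \<in> pverts G"
  have "parcs (graph_join G H) `` {u} = pverts H \<union> parcs G `` {u}"
    using u assms(3) H.in_arcsD1 by (auto simp: graph_join_def)
  moreover have "parcs G `` {u} \<subseteq> pverts G"
    using G.in_arcsD2 by auto
  then have "sum h (pverts H \<union> parcs G `` {u}) = sum h (pverts H) + sum h (parcs G `` {u})"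
    using assms(3) G.pair_finite_verts H.pair_finite_verts
    by (intro sum.union_disjoint) (auto intro: finite_subset)
  ultimately show "k * h u = d + sum h (pverts H) + sum h (parcs G `` {u})"
    using assms(4) u by (simp add: shifted_eigenvector_def graph_join_def)
qed

lemma union_pivot_equations:
  assumes "X + Y \<noteq> 0" and eqs: "d = - X * x" "d = - Y * y"
  shows "d = - g_fun X Y * (x + y)" and "x + y = 0 \<Longrightarrow> x = 0" and "x + y = 0 \<Longrightarrow> y = 0"
proof -
  have "d * (X + Y) = d * Y + d * X"
    by (simp add: algebra_simps)
  also have "d * Y = - X * x * Y"
    unfolding eqs(1) ..
  also have "d * X = - Y * y * X"
    unfolding eqs(2) ..
  also have "- X * x * Y + - Y * y * X = - (X * Y) * (x + y)"
    by (simp add: algebra_simps)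
  finally show d: "d = - g_fun X Y * (x + y)"
    using assms(1) by (simp add: g_fun_def field_simps)
  show "x = 0" if "x + y = 0"
  proof -
    have "y = - x" "d = 0"
      using that d by simp_all
    have "(X + Y) * x = X * x - Y * y"
      unfolding \<open>y = - x\<close> by (simp add: algebra_simps)
    also have "\<dots> = 0"
      using eqs \<open>d = 0\<close> by simp
    finally show ?thesis
      using assms(1) by simp
  qed
  then show "y = 0" if "x + y = 0"
    using that by simp
qed

lemma join_pivot_equations:
  assumes "X + Y \<noteq> 2" and eqs: "d + y = - X * x" "d + x = - Y * y"
  shows "d = - f_fun X Y * (x + y)" and "x + y = 0 \<Longrightarrow> x = 0" and "x + y = 0 \<Longrightarrow> y = 0"
proof -
  have "d * (X + Y - 2) + (X * Y - 1) * (x + y)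
      = (Y - 1) * (d + y + X * x) + (X - 1) * (d + x + Y * y)"
    by (simp add: algebra_simps)
  also have "\<dots> = 0"
    unfolding eqs by simp
  finally have "d * (X + Y - 2) = - (X * Y - 1) * (x + y)"
    by (simp only: eq_neg_iff_add_eq_0 mult_minus_left)
  then have "d = - (X * Y - 1) * (x + y) / (X + Y - 2)"
    using assms(1) by (simp add: nonzero_eq_divide_eq)
  then show d: "d = - f_fun X Y * (x + y)"
    by (simp add: f_fun_def minus_divide_left)
  show "x = 0" if "x + y = 0"
  proof -
    have "y = - x" "d = 0"
      using that d by simp_all
    have "(X + Y - 2) * x = (y + X * x) - (x + Y * y)"
      unfolding \<open>y = - x\<close> by (simp add: algebra_simps)
    also have "\<dots> = 0"
      using eqs \<open>d = 0\<close> by simp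
    finally show ?thesis
      using assms(1) by simp
  qed
  then show "y = 0" if "x + y = 0"
    using that by simp
qed

lemma has_pivot_graph_union:
  assumes "pair_fin_digraph G" "pair_fin_digraph H" and disjoint: "pverts G \<inter> pverts H = {}"
    and pivots: "has_pivot G k X" "has_pivot H k Y" and "X + Y \<noteq> 0"
  shows "has_pivot (graph_union G H) k (g_fun X Y)"
proof -
  interpret G: pair_fin_digraph G by fact
  interpret H: pair_fin_digraph H by fact
  have parts: "shifted_eigenvector G k d h" "shifted_eigenvector H k d h"
    if "shifted_eigenvector (graph_union G H) k d h" for d h
    using that disjoint shifted_eigenvector_graph_union_left[of H G k d h]
      shifted_eigenvector_graph_union_left[of G H k d h]
      G.pair_wf_digraph_axioms H.pair_wf_digraph_axioms
    by (simp_all add: graph_union_commute Int_commute)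
  have total: "sum h (pverts (graph_union G H)) = sum h (pverts G) + sum h (pverts H)"
    for h :: "'a \<Rightarrow> real"
    using sum.union_disjoint[OF G.pair_finite_verts H.pair_finite_verts disjoint]
    by (simp add: graph_union_def)
  show ?thesis
  proof (rule has_pivotI)
    fix d h assume solution: "shifted_eigenvector (graph_union G H) k d h"
    note equations = union_pivot_equations[OF \<open>X + Y \<noteq> 0\<close>
        has_pivot_sum[OF pivots(1) parts(1)[OF solution]]
        has_pivot_sum[OF pivots(2) parts(2)[OF solution]], folded total]
    show "d = - g_fun X Y * sum h (pverts (graph_union G H))"
      by (rule equations(1))
    fix u assume "sum h (pverts (graph_union G H)) = 0" and u: "u \<in> pverts (graph_union G H)"
    then have "sum h (pverts G) = 0" "sum h (pverts H) = 0"
      using equations(2,3) by blast+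
    then show "h u = 0"
      using u pivots[THEN has_pivot_eq_0] parts[OF solution] by (auto simp: graph_union_def)
  qed
qed

lemma has_pivot_graph_join:
  assumes "pair_fin_digraph G" "pair_fin_digraph H" and disjoint: "pverts G \<inter> pverts H = {}"
    and pivots: "has_pivot G k X" "has_pivot H k Y" and "X + Y \<noteq> 2"
  shows "has_pivot (graph_join G H) k (f_fun X Y)"
proof -
  interpret G: pair_fin_digraph G by fact
  interpret H: pair_fin_digraph H by fact
  have parts: "shifted_eigenvector G k (d + sum h (pverts H)) h"
    "shifted_eigenvector H k (d + sum h (pverts G)) h"
    if "shifted_eigenvector (graph_join G H) k d h" for d h
    using that assms shifted_eigenvector_graph_join_left[of G H k d h]
      shifted_eigenvector_graph_join_left[of H G k d h]
    by (simp_all add: graph_join_commute Int_commute)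
  have total: "sum h (pverts (graph_join G H)) = sum h (pverts G) + sum h (pverts H)"
    for h :: "'a \<Rightarrow> real"
    using sum.union_disjoint[OF G.pair_finite_verts H.pair_finite_verts disjoint]
    by (simp add: graph_join_def)
  show ?thesis
  proof (rule has_pivotI)
    fix d h assume solution: "shifted_eigenvector (graph_join G H) k d h"
    note equations = join_pivot_equations[OF \<open>X + Y \<noteq> 2\<close>
        has_pivot_sum[OF pivots(1) parts(1)[OF solution]]
        has_pivot_sum[OF pivots(2) parts(2)[OF solution]], folded total]
    show "d = - f_fun X Y * sum h (pverts (graph_join G H))"
      by (rule equations(1))
    fix u assume "sum h (pverts (graph_join G H)) = 0" and u: "u \<in> pverts (graph_join G H)"
    then have "sum h (pverts G) = 0" "sum h (pverts H) = 0"
      using equations(2,3) by blast+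
    then show "h u = 0"
      using u pivots[THEN has_pivot_eq_0] parts[OF solution] by (auto simp: graph_join_def)
  qed
qed

lemma has_pivot_edgeless_graph_on:
  assumes "finite W" "W \<noteq> {}" "k \<noteq> 0"
  shows "has_pivot (edgeless_graph_on W) k (- (k / real (card W)))"
proof (rule has_pivotI)
  fix d h assume "shifted_eigenvector (edgeless_graph_on W) k d h"
  then have vertex: "k * h u = d" if "u \<in> W" for u
    using that by (simp add: shifted_eigenvector_def edgeless_graph_on_def)
  then have total: "k * sum h W = real (card W) * d"
    by (simp add: sum_distrib_left)
  then show "d = - (- (k / real (card W))) * sum h (pverts (edgeless_graph_on W))"
    using assms by (simp add: edgeless_graph_on_def field_simps)
  fix u assume "sum h (pverts (edgeless_graph_on W)) = 0" "u \<in> pverts (edgeless_graph_on W)"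
  then show "h u = 0"
    using vertex[of u] total assms by (simp add: edgeless_graph_on_def)
qed

lemma has_pivot_complete_graph_on:
  assumes "finite W" "W \<noteq> {}" "k \<noteq> - 1"
  shows "has_pivot (complete_graph_on W) k (1 - (k + 1) / real (card W))"
proof (rule has_pivotI)
  fix d h assume solution: "shifted_eigenvector (complete_graph_on W) k d h"
  have vertex: "(k + 1) * h u = d + sum h W" if "u \<in> W" for u
  proof -
    have "parcs (complete_graph_on W) `` {u} = W - {u}"
      using that by (auto simp: complete_graph_on_def)
    then have "k * h u = d + (sum h W - h u)"
      using that solution assms(1)
      by (simp add: shifted_eigenvector_def complete_graph_on_def sum_diff1)
    then show ?thesis
      by (simp add: algebra_simps)
  qed
  then have total: "(k + 1) * sum h W = real (card W) * (d + sum h W)"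
    by (simp add: sum_distrib_left)
  then show "d = - (1 - (k + 1) / real (card W)) * sum h (pverts (complete_graph_on W))"
    using assms(1,2) by (simp add: complete_graph_on_def field_simps)
  fix u assume "sum h (pverts (complete_graph_on W)) = 0" "u \<in> pverts (complete_graph_on W)"
  then show "h u = 0"
    using vertex[of u] total assms by (simp add: complete_graph_on_def)
qed


section \<open>Monotonicity of the pivot recursion\<close>

lemma g_fun_commute: "g_fun X Y = g_fun Y X"
  by (simp add: g_fun_def ac_simps)

lemma g_fun_mono_left:
  assumes "0 < X + Y" "X \<le> X'"
  shows "g_fun X Y \<le> g_fun X' Y"
proof -
  have g_fun_eq: "g_fun Z Y = Y - Y\<^sup>2 / (Z + Y)" if "0 < Z + Y" for Z
    using that by (simp add: g_fun_def field_simps power2_eq_square)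
  have "Y\<^sup>2 / (X' + Y) \<le> Y\<^sup>2 / (X + Y)"
    using assms by (intro divide_left_mono) auto
  then show ?thesis
    using assms by (simp add: g_fun_eq)
qed

lemma g_fun_mono:
  assumes "0 < X + Y" "X \<le> X'" "Y \<le> Y'"
  shows "g_fun X Y \<le> g_fun X' Y'"
proof -
  have "g_fun X Y \<le> g_fun X' Y"
    using assms by (intro g_fun_mono_left)
  also have "\<dots> = g_fun Y X'"
    by (rule g_fun_commute)
  also have "\<dots> \<le> g_fun Y' X'"
    using assms by (intro g_fun_mono_left) auto
  finally show ?thesis
    by (simp add: g_fun_commute)
qed

lemma one_minus_f_fun:
  assumes "X + Y \<noteq> 2"
  shows "1 - f_fun X Y = g_fun (1 - X) (1 - Y)"
proof -
  have denominator: "(1 - X) + (1 - Y) = - (X + Y - 2)"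
    by simp
  show ?thesis
    unfolding f_fun_def g_fun_def denominator using assms by (simp add: field_simps)
qed

lemma f_fun_mono:
  assumes "X' + Y' < 2" "X \<le> X'" "Y \<le> Y'"
  shows "f_fun X Y \<le> f_fun X' Y'"
proof -
  have "g_fun (1 - X') (1 - Y') \<le> g_fun (1 - X) (1 - Y)"
    using assms by (intro g_fun_mono) auto
  then show ?thesis
    using assms one_minus_f_fun[of X Y] one_minus_f_fun[of X' Y'] by simp
qed

lemma f_fun_less_one:
  assumes "X < 1" "Y < 1"
  shows "f_fun X Y < 1"
proof -
  have "0 < g_fun (1 - X) (1 - Y)"
    using assms by (simp add: g_fun_def)
  then show ?thesis
    using assms one_minus_f_fun[of X Y] by simp
qed


section \<open>Bounds for the pivots of threshold graphs\<close>

lemma pair_fin_digraph_complete_graph_on: "finite W \<Longrightarrow> pair_fin_digraph (complete_graph_on W)"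
  by unfold_locales (auto simp: complete_graph_on_def intro: finite_subset[of _ "W \<times> W"])

lemma pair_fin_digraph_edgeless_graph_on: "finite W \<Longrightarrow> pair_fin_digraph (edgeless_graph_on W)"
  by unfold_locales (auto simp: edgeless_graph_on_def)

lemma add_dominating_eq_graph_join: "add_dominating W G = graph_join (complete_graph_on W) G"
  by (auto simp: add_dominating_def graph_join_def complete_graph_on_def)

lemma add_isolated_eq_graph_union: "add_isolated W G = graph_union (edgeless_graph_on W) G"
  by (simp add: add_isolated_def graph_union_def edgeless_graph_on_def)

definition has_pivot_in :: "'a pair_pre_digraph \<Rightarrow> real \<Rightarrow> real set \<Rightarrow> bool" where
  "has_pivot_in G k S \<longleftrightarrow> (\<exists>\<sigma>\<in>S. has_pivot G k \<sigma>)"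

lemma has_pivot_in_complete_graph_on:
  assumes "finite W" "- 1 < k" "k \<le> N" "N + 1 < real (card W)"
  shows "has_pivot_in (complete_graph_on W) k {1 - (N + 1) / real (card W)..<1}"
proof -
  have "W \<noteq> {}"
    using assms by auto
  then have "has_pivot (complete_graph_on W) k (1 - (k + 1) / real (card W))"
    using assms by (intro has_pivot_complete_graph_on) auto
  moreover have "(k + 1) / real (card W) \<le> (N + 1) / real (card W)"
    using assms by (intro divide_right_mono) auto
  ultimately show ?thesis
    using assms unfolding has_pivot_in_def by force
qed

lemma has_pivot_in_add_isolated:
  assumes "pair_fin_digraph G" "finite W" "W \<noteq> {}" "W \<inter> pverts G = {}"
    and k: "0 < k" "k \<le> N" and card_W: "0 < s" "N / s < real (card W)"
    and pivot: "has_pivot_in G k {s..<b}"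
  shows "has_pivot_in (add_isolated W G) k {g_fun s (- (N / real (card W)))..<0}"
proof -
  obtain \<sigma> where \<sigma>: "s \<le> \<sigma>" "has_pivot G k \<sigma>"
    using pivot by (auto simp: has_pivot_in_def)
  define q Q where "q = k / real (card W)" and "Q = N / real (card W)"
  have card_pos: "0 < real (card W)"
    using assms(2,3) by (simp add: card_gt_0_iff)
  have q: "0 < q" "q \<le> Q" and Q: "Q < s"
    using k card_W card_pos by (auto simp: q_def Q_def field_simps)
  have "has_pivot (add_isolated W G) k (g_fun (- q) \<sigma>)"
    unfolding add_isolated_eq_graph_union q_def
    using assms \<sigma> q Q
    by (intro has_pivot_graph_union has_pivot_edgeless_graph_on pair_fin_digraph_edgeless_graph_on)
      (auto simp: edgeless_graph_on_def simp flip: q_def)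
  moreover have "g_fun s (- Q) \<le> g_fun \<sigma> (- q)"
    using \<sigma>(1) q Q by (intro g_fun_mono) auto
  moreover have "g_fun \<sigma> (- q) < 0"
    using \<sigma>(1) q Q by (simp add: g_fun_def divide_less_0_iff)
  ultimately show ?thesis
    by (auto simp: has_pivot_in_def Q_def g_fun_commute)
qed

lemma has_pivot_in_add_dominating:
  assumes "pair_fin_digraph G" "finite W" "W \<noteq> {}" "W \<inter> pverts G = {}"
    and k: "- 1 < k" "k \<le> N" and card_W: "(N + 1) / (1 - 1 / s) < real (card W)"
    and pivot: "has_pivot_in G k {s..<0}"
  defines "s' \<equiv> f_fun s (1 - (N + 1) / real (card W))"
  shows "0 < s'" "has_pivot_in (add_dominating W G) k {s'..<1}"
proof -
  obtain \<sigma> where \<sigma>: "s \<le> \<sigma>" "\<sigma> < 0" "has_pivot G k \<sigma>"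
    using pivot by (auto simp: has_pivot_in_def)
  define q Q where "q = (k + 1) / real (card W)" and "Q = (N + 1) / real (card W)"
  have card_pos: "0 < real (card W)"
    using assms(2,3) by (simp add: card_gt_0_iff)
  have q: "0 < q" "q \<le> Q"
    using k card_pos by (auto simp: q_def Q_def divide_right_mono)
  have "0 < 1 - 1 / s"
    using \<sigma> by (simp add: field_simps)
  then have "Q < 1 - 1 / s"
    using card_W card_pos by (simp add: Q_def pos_divide_less_eq mult.commute)
  then have "s * (1 - Q) < 1"
    using \<sigma> by (simp add: field_simps)
  then show "0 < s'"
    using \<sigma> q by (auto simp: s'_def f_fun_def simp flip: Q_def intro!: divide_neg_neg)
  have "s' \<le> f_fun \<sigma> (1 - q)"
    using \<sigma> q by (auto simp: s'_def simp flip: Q_def intro!: f_fun_mono)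
  moreover have "has_pivot (add_dominating W G) k (f_fun (1 - q) \<sigma>)"
    unfolding add_dominating_eq_graph_join q_def
    using assms \<sigma> q
    by (intro has_pivot_graph_join has_pivot_complete_graph_on pair_fin_digraph_complete_graph_on)
      (auto simp: complete_graph_on_def mult.commute simp flip: q_def)
  moreover have "f_fun \<sigma> (1 - q) < 1"
    using \<sigma> q by (intro f_fun_less_one) auto
  ultimately show "has_pivot_in (add_dominating W G) k {s'..<1}"
    by (auto simp: has_pivot_in_def f_fun_def ac_simps)
qed

lemma finite_level_verts: "finite (level_verts i m)"
  by (simp add: level_verts_def)

lemma card_level_verts: "card (level_verts i m) = m"
  by (simp add: level_verts_def card_cartesian_product)

lemma level_verts_eq_empty_iff: "level_verts i m = {} \<longleftrightarrow> m = 0"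
  by (auto simp: level_verts_def)

lemma pair_fin_digraph_threshold_from: "pair_fin_digraph (threshold_from i as)"
  using pair_graph_threshold_from by (metis pair_graph.axioms(1) pair_digraph.axioms(1))

lemma threshold_from_Suc:
  assumes "i < r"
  shows "threshold_from i (map a [i..<r + 1]) =
    (if odd i then add_dominating else add_isolated) (level_verts i (a i))
      (threshold_from (Suc i) (map a [Suc i..<r + 1]))"
proof -
  have "[i..<r + 1] = i # Suc i # [Suc (Suc i)..<r + 1]"
    "[Suc i..<r + 1] = Suc i # [Suc (Suc i)..<r + 1]"
    using assms by (simp_all add: upt_conv_Cons del: upt_Suc)
  then show ?thesis
    by simp
qed

theorem theorem5:
  fixes N :: real and r :: nat and a :: "nat \<Rightarrow> nat" and s :: "nat \<Rightarrow> real"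
  assumes "N > 0" and "odd r"
    and "\<And>i. 1 \<le> i \<Longrightarrow> i \<le> r \<Longrightarrow> a i > 0"
    and "real (a r) > N + 1"
    and "s r = 1 - (N + 1) / real (a r)"
    and "\<And>i. 1 \<le> i \<Longrightarrow> i < r \<Longrightarrow> even i \<Longrightarrow>
           real (a i) > N / s (i + 1) \<and> s i = g_fun (s (i + 1)) (- (N / real (a i)))"
    and "\<And>i. 1 \<le> i \<Longrightarrow> i < r \<Longrightarrow> odd i \<Longrightarrow>
           real (a i) > (N + 1) / (1 - 1 / s (i + 1)) \<and>
           s i = f_fun (s (i + 1)) (1 - (N + 1) / real (a i))"
  shows "eigenvalue_free {0<..N} (threshold_graph (map a [1..<r + 1]))"
proof -
  define G where "G i = threshold_from i (map a [i..<r + 1])" for i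
  have G_fin: "pair_fin_digraph (G i)" for i
    unfolding G_def by (rule pair_fin_digraph_threshold_from)
  have pivots: "(odd i \<longrightarrow> 0 < s i) \<and> has_pivot_in (G i) k {s i..<of_bool (odd i)}"
    if "i \<le> r" "1 \<le> i" and k: "0 < k" "k \<le> N" for i k
    using that(1,2)
  proof (induction rule: inc_induct)
    case base
    show ?case
      using has_pivot_in_complete_graph_on[of "level_verts r (a r)" k N] assms(1,2,4,5) k
      by (simp add: G_def finite_level_verts card_level_verts)
  next
    case (step i)
    have level: "level_verts i (a i) \<noteq> {}" "level_verts i (a i) \<inter> pverts (G (Suc i)) = {}"
      using assms(3)[of i] step by (simp_all add: G_def level_verts_eq_empty_iff level_verts_disjoint)
    show ?case
      using has_pivot_in_add_isolated[OF G_fin finite_level_verts level k, of "s (i + 1)" 1]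
        has_pivot_in_add_dominating[OF G_fin finite_level_verts level _ k(2), of "s (i + 1)"]
        assms(6,7)[of i] step k threshold_from_Suc[of i r a, folded G_def]
      by (cases "odd i") (simp_all add: card_level_verts)
  qed
  have "\<not> graph_eigenvalue (G 1) k" if "0 < k" "k \<le> N" for k
    using pivots[OF _ _ that, of 1] odd_pos[OF \<open>odd r\<close>]
      has_pivot_imp_not_graph_eigenvalue[OF pair_fin_digraph.axioms(1)[OF G_fin]]
    by (fastforce simp: has_pivot_in_def)
  then show ?thesis
    by (simp add: eigenvalue_free_def threshold_graph_def G_def)
qed

end
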